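(* Let $\pi=(\pi_i)_{i\ge1}$ be a non-increasing probability distribution on $\mathbb{N}=\{1,2,\ldots\}$; for each $N\in\mathbb{N}$ let $\pi_N$ be the truncation of $\pi$ to $\{1,\ldots,N\}$, let $R_N$ be a random variable with distribution $\pi_N$, and let $C_N$ be the stationary search cost under the transposition rule for the list $\{1,\ldots,N\}$ with request distribution $\pi_N$. Let either (i) $\pi$ be a power law with parameter $\alpha>1$, and $x/N<\gamma$ for some fixed $\gamma<1$; or (ii) $\pi$ be asymptotically geometric with parameter $0<\nu<1$, and $x<N$. Then $$\lim_{\{x,N\}\to\infty}\frac{\log\mathbb{P}[C_N>x]}{\log\mathbb{P}[R_N>x]}=1,$$ where the limit is taken as the positive integers $x$ and $N$ jointly tend to infinity subject to the constraint $x/N<\gamma$ in case (i), respectively $x<N$ in case (ii).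
   Context: $\pi$ is a power law with parameter $\alpha>1$ if $\pi_i=c\,i^{-\alpha}$ for all $i\ge1$, where $c^{-1}=\sum_{i\ge1}i^{-\alpha}$. $\pi$ is asymptotically geometric with parameter $0<\nu<1$ if $i^{-1}\log\pi_i\to\log\nu$ as $i\to\infty$. With $\mathbb{P}[R=i]=\pi_i$, the truncated distribution $\pi_N$ is the distribution $\pi$ conditioned on $\{i\le N\}$, so that $\mathbb{P}[R_N>x]:=\mathbb{P}[R>x\mid R\le N]$. Model. The items $1,\ldots,N$ are arranged in a list occupying positions $1,\ldots,N$. At each integer time an item is requested, the requests being i.i.d. with distribution $\pi_N$. Transposition rule: upon every request, the requested item is swapped with the item immediately in front of it (one position closer to position 1); if the requested item is in position $1$, the list does not change. The list order is then an irreducible aperiodic Markov chain on the permutations of $\{1,\ldots,N\}$ and has a unique stationary distribution. The stationary search cost $C_N$ is the position of the requested item when the list order has the stationary distribution and the requested item, distributed as $\pi_N$, is independent of the list order. *)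

theory Defs
  imports "HOL-Probability.Probability" "HOL-Combinatorics.Combinatorics"
begin

text \<open>
  Probability distributions on the positive integers are values of type \<^typ>\<open>nat pmf\<close>
  whose support does not contain 0.
\<close>

definition nonincreasing_distribution :: "nat pmf \<Rightarrow> bool" where
  "nonincreasing_distribution \<pi> \<longleftrightarrow>
     set_pmf \<pi> \<subseteq> {1..} \<and> (\<forall>i j. 1 \<le> i \<longrightarrow> i \<le> j \<longrightarrow> pmf \<pi> j \<le> pmf \<pi> i)"

definition power_law :: "real \<Rightarrow> nat pmf \<Rightarrow> bool" where
  "power_law \<alpha> \<pi> \<longleftrightarrow> 1 < \<alpha> \<and>
     (\<forall>i\<ge>1. pmf \<pi> i = inverse (\<Sum>\<^sub>\<infinity>k\<in>{1..}. real k powr (-\<alpha>)) * real i powr (-\<alpha>))"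

text \<open>
  Since \<^term>\<open>ln (0::real) = 0\<close> whereas \<^term>\<open>ln \<nu> < 0\<close>, the limit below forces the
  point masses to be eventually positive.
\<close>

definition asymptotically_geometric :: "real \<Rightarrow> nat pmf \<Rightarrow> bool" where
  "asymptotically_geometric \<nu> \<pi> \<longleftrightarrow> 0 < \<nu> \<and> \<nu> < 1 \<and>
     ((\<lambda>i. ln (pmf \<pi> i) / real i) \<longlongrightarrow> ln \<nu>) sequentially"

definition truncated :: "nat pmf \<Rightarrow> nat \<Rightarrow> nat pmf" where
  "truncated \<pi> N = cond_pmf \<pi> {..N}"

text \<open>
  A list order of the items \<open>1, \<dots>, N\<close> is a permutation \<open>\<sigma>\<close> of \<open>{1..N}\<close>, where
  \<open>\<sigma> i\<close> is the position of item \<open>i\<close>.  Swapping two items thus acts by composing a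
  transposition of positions on the left.
\<close>

definition transposition_rule :: "nat \<Rightarrow> (nat \<Rightarrow> nat) \<Rightarrow> (nat \<Rightarrow> nat)" where
  "transposition_rule r \<sigma> =
     (if \<sigma> r = 1 then \<sigma> else Transposition.transpose (\<sigma> r - 1) (\<sigma> r) \<circ> \<sigma>)"

definition list_kernel :: "nat pmf \<Rightarrow> (nat \<Rightarrow> nat) \<Rightarrow> (nat \<Rightarrow> nat) pmf" where
  "list_kernel q \<sigma> = map_pmf (\<lambda>r. transposition_rule r \<sigma>) q"

definition is_stationary :: "nat \<Rightarrow> nat pmf \<Rightarrow> (nat \<Rightarrow> nat) pmf \<Rightarrow> bool" where
  "is_stationary N q \<mu> \<longleftrightarrow>
     set_pmf \<mu> \<subseteq> {\<sigma>. \<sigma> permutes {1..N}} \<and> bind_pmf \<mu> (list_kernel q) = \<mu>"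

definition stationary_distribution :: "nat \<Rightarrow> nat pmf \<Rightarrow> (nat \<Rightarrow> nat) pmf" where
  "stationary_distribution N q = (THE \<mu>. is_stationary N q \<mu>)"

definition search_cost :: "nat \<Rightarrow> nat pmf \<Rightarrow> nat pmf" where
  "search_cost N q =
     map_pmf (\<lambda>(\<sigma>, r). \<sigma> r) (pair_pmf (stationary_distribution N q) q)"

definition log_tail_ratio :: "nat pmf \<Rightarrow> nat \<times> nat \<Rightarrow> real" where
  "log_tail_ratio \<pi> = (\<lambda>(x, N).
     ln (measure_pmf.prob (search_cost N (truncated \<pi> N)) {x<..}) /
     ln (measure_pmf.prob (truncated \<pi> N) {x<..}))"

text \<open>Both components tend to infinity jointly, subject to the constraint \<open>P\<close>.\<close>

definition joint_at_top :: "(nat \<Rightarrow> nat \<Rightarrow> bool) \<Rightarrow> (nat \<times> nat) filter" where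
  "joint_at_top P = inf (at_top \<times>\<^sub>F at_top) (principal {(x, N). P x N})"

end

theory Submission
  imports Defs "HOL-Real_Asymp.Real_Asymp"
begin

text \<open>
  The transposition chain is reversible: writing \<open>q\<close> for the request distribution, its
  stationary law gives a list order \<open>\<sigma>\<close> a probability proportional to the product of
  \<open>q\<^sub>i\<close> to the power \<open>N - \<sigma> i\<close>.  Exchanging the items \<open>i < j\<close> in an order that has
  \<open>j\<close> at least \<open>m\<close> places in front of \<open>i\<close> therefore multiplies the weight by at least
  \<open>(q\<^sub>i / q\<^sub>j)\<close> to the power \<open>m\<close>, so that such an inversion has probability at most
  \<open>(q\<^sub>j / q\<^sub>i)\<close> to the power \<open>m\<close> (\<open>prob_far_inversion\<close>).

  Write \<open>T x\<close> for the tail \<open>P[R\<^sub>N > x]\<close>.  Whatever the order of the list, the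
  \<open>N - x\<close> items beyond position \<open>x\<close> are requested at least as often as the \<open>N - x\<close> least
  popular items, so \<open>T x \<le> P[C\<^sub>N > x]\<close> and the ratio of logarithms is at most 1.
  In the other direction, suppose that an item \<open>i \<le> x - d\<close> sits beyond position \<open>x\<close>.  The
  first \<open>x - d\<close> positions cannot all be taken by items from \<open>1, \<dots>, x - d\<close>, so one of them
  holds some \<open>j > x - d\<close>, and this \<open>j\<close> precedes \<open>i\<close> by at least \<open>d + 1\<close> places.
  Splitting the requests at an item \<open>y \<le> x - d\<close> and summing the inversion bound over \<open>i \<le> y\<close>
  and \<open>j > x - d\<close> yields (\<open>search_cost_le\<close>)
  \[ P[C_N > x] \le T(y) + y (q_{x-d} / q_y)^d \, T(x-d). \]

  For an asymptotically geometric distribution the choice \<open>d = 0\<close>, \<open>y = x\<close> is enough: it loses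
  a factor \<open>1 + x\<close>, which is negligible on the logarithmic scale because \<open>T x\<close> is exponentially
  small.  For a power law that factor would matter, since \<open>T x\<close> is itself a power of \<open>x\<close>.
  There \<open>y\<close> is taken of the order of \<open>x\<close> to the power \<open>1 - \<epsilon>\<close>, and \<open>d\<close> a constant
  with \<open>\<epsilon> d \<ge> 1\<close>; the second summand is then \<open>O(T x)\<close>, while
  \<open>T y\<close> has a logarithm asymptotic to \<open>1 - \<epsilon>\<close> times that of \<open>T x\<close>.  The
  constraint \<open>x / N < \<gamma> < 1\<close> keeps the truncation from diminishing \<open>T x\<close> by more than a
  constant factor.
\<close>

section \<open>Moves of the list chain\<close>

text \<open>
  The move of the chain as a permutation of positions: a request for the item at position \<open>k\<close>
  composes the order with \<open>forward_swap k\<close>, whichever item that is.  Being an involution, it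
  makes transition probabilities easy to read backwards.
\<close>

definition forward_swap :: "nat \<Rightarrow> nat \<Rightarrow> nat" where
  "forward_swap k = (if k = 1 then id else Transposition.transpose (k - 1) k)"

lemma transposition_rule_eq: "transposition_rule r \<sigma> = forward_swap (\<sigma> r) \<circ> \<sigma>"
  by (simp add: transposition_rule_def forward_swap_def)

lemma forward_swap_comp_self [simp]: "forward_swap k \<circ> (forward_swap k \<circ> \<sigma>) = \<sigma>"
  by (auto simp: forward_swap_def fun_eq_iff)

lemma forward_swap_permutes: "k \<in> {1..N} \<Longrightarrow> forward_swap k permutes {1..N}"
  by (auto simp: forward_swap_def permutes_id intro!: permutes_swap_id)

text \<open>
  Irreducibility: the moves are all the transpositions of adjacent positions, and conjugating
  by them produces every transposition, hence every permutation.
\<close>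

lemma closed_under_forward_swaps:
  assumes closed: "\<And>\<sigma> k. \<sigma> \<in> S \<Longrightarrow> k \<in> {1..N} \<Longrightarrow> forward_swap k \<circ> \<sigma> \<in> S"
    and start: "\<sigma>\<^sub>0 \<in> S" and tau: "\<tau> permutes {1..N}"
  shows "\<tau> \<circ> \<sigma>\<^sub>0 \<in> S"
proof -
  have less: "Transposition.transpose a b \<circ> \<sigma> \<in> S"
    if "1 \<le> a" "a < b" "b \<le> N" "\<sigma> \<in> S" for a b \<sigma>
    using that
  proof (induction "b - a" arbitrary: b \<sigma>)
    case 0
    then show ?case by simp
  next
    case (Suc n)
    show ?case
    proof (cases "b = Suc a")
      case True
      then show ?thesis
        using closed[of \<sigma> b] Suc.prems by (simp add: forward_swap_def)
    next
      case False
      let ?s = "forward_swap b"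
      have s: "?s = Transposition.transpose (b - 1) b"
        using Suc.prems by (auto simp: forward_swap_def)
      have "Transposition.transpose a (b - 1) \<circ> (?s \<circ> \<sigma>) \<in> S"
        using Suc closed[of \<sigma> b] False by (intro Suc.hyps(1)) auto
      then have "?s \<circ> (Transposition.transpose a (b - 1) \<circ> (?s \<circ> \<sigma>)) \<in> S"
        using closed Suc.prems by auto
      moreover have "?s \<circ> (Transposition.transpose a (b - 1) \<circ> (?s \<circ> \<sigma>))
          = Transposition.transpose a b \<circ> \<sigma>"
        using transpose_comp_triple[of b a "b - 1"] Suc.prems False unfolding s
        by (simp add: comp_assoc[symmetric] transpose_commute[of b]
            transpose_commute[of "b - 1" a] transpose_commute[of "b - Suc 0" a])
      ultimately show ?thesis by simp
    qed
  qed
  have transposed: "Transposition.transpose a b \<circ> \<sigma> \<in> S"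
    if "a \<in> {1..N}" "b \<in> {1..N}" "\<sigma> \<in> S" for a b \<sigma>
    using less[of a b \<sigma>] less[of b a \<sigma>] that
    by (cases a b rule: linorder_cases) (auto simp: transpose_commute)
  from tau finite_atLeastAtMost show ?thesis
  proof (induction \<tau> rule: permutes_induct)
    case id
    then show ?case using start by simp
  next
    case (swap a b p)
    then show ?case unfolding comp_assoc by (intro transposed)
  qed
qed

section \<open>The stationary distribution\<close>

locale request_distribution =
  fixes N :: nat and q :: "nat pmf"
  assumes support: "set_pmf q = {1..N}"
begin

abbreviation orders :: "(nat \<Rightarrow> nat) set" where
  "orders \<equiv> {\<sigma>. \<sigma> permutes {1..N}}"

text \<open>
  The exponent is a natural number on list orders, since then \<open>\<sigma> i \<le> N\<close>; up to a constant
  factor this is the product of \<open>q\<^sub>i\<close> to the power \<open>- \<sigma> i\<close>.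
\<close>

definition weight :: "(nat \<Rightarrow> nat) \<Rightarrow> real" where
  "weight \<sigma> = (\<Prod>i\<in>{1..N}. pmf q i ^ (N - \<sigma> i))"

definition total_weight :: real where
  "total_weight = sum weight orders"

definition product_form :: "(nat \<Rightarrow> nat) pmf" where
  "product_form = embed_pmf (\<lambda>\<sigma>. if \<sigma> \<in> orders then weight \<sigma> / total_weight else 0)"

lemma finite_orders: "finite orders"
  by (rule finite_permutations) simp

lemmas [simp] = finite_orders finite_orders[unfolded One_nat_def]

lemma pmf_pos: "i \<in> {1..N} \<Longrightarrow> 0 < pmf q i"
  using support by (simp add: pmf_positive_iff)

lemma N_pos: "1 \<le> N"
  using set_pmf_not_empty[of q] support by auto

lemma sum_request_pmf: "(\<Sum>i\<in>{1..N}. pmf q i) = 1"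
  by (rule sum_pmf_eq_1) (auto simp: support)

lemma weight_pos: "0 < weight \<sigma>"
  unfolding weight_def by (intro prod_pos) (auto intro!: zero_less_power pmf_pos)

lemma total_weight_pos: "0 < total_weight"
  unfolding total_weight_def
  by (intro sum_pos weight_pos) (auto intro!: exI[of _ id] permutes_id)

lemma pmf_product_form:
  "pmf product_form \<sigma> = (if \<sigma> \<in> orders then weight \<sigma> / total_weight else 0)"
  unfolding product_form_def
proof (rule pmf_embed_pmf)
  let ?f = "\<lambda>\<sigma>. if \<sigma> \<in> orders then weight \<sigma> / total_weight else 0"
  show "0 \<le> ?f \<tau>" for \<tau>
    using weight_pos[of \<tau>] total_weight_pos by auto
  have "(\<integral>\<^sup>+ \<tau>. ennreal (?f \<tau>) \<partial>count_space UNIV) = (\<Sum>\<tau>\<in>orders. ennreal (?f \<tau>))"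
    by (rule nn_integral_count_space') (auto split: if_splits)
  also have "\<dots> = ennreal (\<Sum>\<tau>\<in>orders. weight \<tau> / total_weight)"
    using weight_pos total_weight_pos by (subst sum_ennreal) (auto intro: less_imp_le)
  also have "(\<Sum>\<tau>\<in>orders. weight \<tau> / total_weight) = 1"
    using total_weight_pos by (simp add: sum_divide_distrib[symmetric] total_weight_def)
  finally show "(\<integral>\<^sup>+ \<tau>. ennreal (?f \<tau>) \<partial>count_space UNIV) = 1" by simp
qed

lemma set_product_form: "set_pmf product_form = orders"
  using weight_pos total_weight_pos
  by (auto simp: set_pmf_eq pmf_product_form) (metis less_irrefl)

text \<open>
  Exchanging two items changes only their two factors.  With adjacent positions this is detailed
  balance, and with distant positions it makes inversions of unequally popular items unlikely.
\<close>

lemma weight_swap: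
  assumes "\<sigma> \<in> orders" "a \<in> {1..N}" "b \<in> {1..N}" "\<sigma> a < \<sigma> b"
  shows "weight (\<sigma> \<circ> Transposition.transpose a b) * pmf q a ^ (\<sigma> b - \<sigma> a)
       = weight \<sigma> * pmf q b ^ (\<sigma> b - \<sigma> a)"
proof -
  have ab: "a \<noteq> b" using assms by auto
  have sb: "\<sigma> b \<le> N"
    using assms permutes_in_image[of \<sigma> "{1..N}" b] by auto
  let ?A = "{1..N} - {a} - {b}"
  have split: "weight \<tau> = pmf q a ^ (N - \<tau> a) * pmf q b ^ (N - \<tau> b)
      * (\<Prod>i\<in>?A. pmf q i ^ (N - \<tau> i))" for \<tau>
    using assms ab unfolding weight_def
    by (subst prod.remove[of _ a], simp, simp, subst prod.remove[of _ b]) (auto simp: mult.assoc)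
  have rest: "(\<Prod>i\<in>?A. pmf q i ^ (N - (\<sigma> \<circ> Transposition.transpose a b) i))
      = (\<Prod>i\<in>?A. pmf q i ^ (N - \<sigma> i))"
    by (intro prod.cong) auto
  define d where "d = \<sigma> b - \<sigma> a"
  have eq: "N - \<sigma> a = (N - \<sigma> b) + d"
    using assms(4) sb by (simp add: d_def)
  show ?thesis
    unfolding split rest d_def[symmetric] by (simp add: eq power_add mult_ac)
qed

text \<open>
  Detailed balance, indexed by the position \<open>k\<close> of the request: both sides are the weight of the
  order times the probability of requesting the item that it has at position \<open>k\<close>, and the move
  through \<open>k\<close> leads back and forth between the two orders.
\<close>

lemma weight_forward_swap:
  assumes "\<sigma> \<in> orders" "k \<in> {1..N}"
  shows "weight (forward_swap k \<circ> \<sigma>) * pmf q (inv (forward_swap k \<circ> \<sigma>) k)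
       = weight \<sigma> * pmf q (inv \<sigma> k)"
proof (cases "k = 1")
  case True
  then show ?thesis by (simp add: forward_swap_def)
next
  case False
  have s: "\<sigma> permutes {1..N}" using assms by simp
  note inv_in = permutes_in_image[OF permutes_inv[OF s]]
  define a b where "a = inv \<sigma> (k - 1)" and "b = inv \<sigma> k"
  have a: "\<sigma> a = k - 1" "a \<in> {1..N}" and b: "\<sigma> b = k" "b \<in> {1..N}"
    using False assms(2) inv_in[of k] inv_in[of "k - 1"]
    by (auto simp: a_def b_def permutes_inverses[OF s])
  have swap: "forward_swap k \<circ> \<sigma> = \<sigma> \<circ> Transposition.transpose a b"
    using False transpose_comp_eq[OF permutes_bij[OF s], of "k - 1" k]
    by (simp add: forward_swap_def a_def b_def)
  have p: "forward_swap k \<circ> \<sigma> permutes {1..N}"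
    using s forward_swap_permutes[OF assms(2)] by (rule permutes_compose)
  have "(forward_swap k \<circ> \<sigma>) a = k" by (simp add: swap b)
  then have "inv (forward_swap k \<circ> \<sigma>) k = a"
    using permutes_inverses(2)[OF p, of a] by simp
  with weight_swap[OF assms(1) a(2) b(2)] a b False assms(2) show ?thesis
    by (simp add: swap b_def[symmetric])
qed

text \<open>
  One step of the chain, summed over the position of the requested item rather than over
  the items.  Since each move is its own inverse, the only predecessor of \<open>\<tau>\<close> through
  position \<open>k\<close> is \<open>forward_swap k \<circ> \<tau>\<close>.
\<close>

lemma pmf_step:
  assumes mu: "set_pmf \<mu> \<subseteq> orders" and tau: "\<tau> \<in> orders"
  shows "pmf (bind_pmf \<mu> (list_kernel q)) \<tau>
       = (\<Sum>k\<in>{1..N}. pmf \<mu> (forward_swap k \<circ> \<tau>) * pmf q (inv (forward_swap k \<circ> \<tau>) k))"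
proof -
  have kernel: "pmf (list_kernel q \<sigma>) \<tau>
      = (\<Sum>k\<in>{1..N}. pmf q (inv \<sigma> k) * of_bool (\<sigma> = forward_swap k \<circ> \<tau>))"
    if "\<sigma> \<in> orders" for \<sigma>
  proof -
    have s: "\<sigma> permutes {1..N}" using that by simp
    have "pmf (list_kernel q \<sigma>) \<tau>
        = (\<Sum>r\<in>{1..N}. pmf q r * of_bool (forward_swap (\<sigma> r) \<circ> \<sigma> = \<tau>))"
      unfolding list_kernel_def map_pmf_def pmf_bind transposition_rule_eq
      by (subst integral_measure_pmf_real[where A = "{1..N}"])
         (auto simp: support indicator_def intro!: sum.cong)
    also have "\<dots> = (\<Sum>k\<in>{1..N}. pmf q (inv \<sigma> k) * of_bool (forward_swap k \<circ> \<sigma> = \<tau>))"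
      by (subst sum.permute[OF permutes_inv[OF s]]) (simp add: o_def permutes_inverses[OF s])
    also have "\<dots> = (\<Sum>k\<in>{1..N}. pmf q (inv \<sigma> k) * of_bool (\<sigma> = forward_swap k \<circ> \<tau>))"
      using forward_swap_comp_self by (intro sum.cong) (auto simp: of_bool_def)
    finally show ?thesis .
  qed
  have "pmf (bind_pmf \<mu> (list_kernel q)) \<tau> = (\<Sum>\<sigma>\<in>orders. pmf (list_kernel q \<sigma>) \<tau> * pmf \<mu> \<sigma>)"
    unfolding pmf_bind using mu by (intro integral_measure_pmf_real) auto
  also have "\<dots> = (\<Sum>\<sigma>\<in>orders. \<Sum>k\<in>{1..N}.
      (pmf \<mu> \<sigma> * pmf q (inv \<sigma> k)) * of_bool (\<sigma> = forward_swap k \<circ> \<tau>))"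
    by (intro sum.cong) (simp_all only: kernel mem_Collect_eq sum_distrib_left sum_distrib_right mult_ac)
  also have "\<dots> = (\<Sum>k\<in>{1..N}. \<Sum>\<sigma>\<in>orders.
      (pmf \<mu> \<sigma> * pmf q (inv \<sigma> k)) * of_bool (\<sigma> = forward_swap k \<circ> \<tau>))"
    by (rule sum.swap)
  also have "\<dots> = (\<Sum>k\<in>{1..N}.
      pmf \<mu> (forward_swap k \<circ> \<tau>) * pmf q (inv (forward_swap k \<circ> \<tau>) k))"
  proof (intro sum.cong refl)
    fix k assume "k \<in> {1..N}"
    then have "forward_swap k \<circ> \<tau> \<in> orders"
      using tau forward_swap_permutes permutes_compose by blast
    then show "(\<Sum>\<sigma>\<in>orders. (pmf \<mu> \<sigma> * pmf q (inv \<sigma> k)) * of_bool (\<sigma> = forward_swap k \<circ> \<tau>))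
        = pmf \<mu> (forward_swap k \<circ> \<tau>) * pmf q (inv (forward_swap k \<circ> \<tau>) k)"
      by (subst sum.remove[of _ "forward_swap k \<circ> \<tau>"]) (auto intro!: sum.neutral)
  qed
  finally show ?thesis .
qed

lemma set_step: 
  assumes "set_pmf \<mu> \<subseteq> orders"
  shows "set_pmf (bind_pmf \<mu> (list_kernel q)) \<subseteq> orders"
proof -
  have "transposition_rule r \<sigma> \<in> orders" if "\<sigma> \<in> orders" "r \<in> {1..N}" for r \<sigma>
  proof -
    have s: "\<sigma> permutes {1..N}" using that by simp
    then have "\<sigma> r \<in> {1..N}" using that(2) permutes_in_image[OF s] by blast
    then show ?thesis
      unfolding transposition_rule_eq
      using permutes_compose[OF s forward_swap_permutes] by simp
  qed
  with assms show ?thesis by (auto simp: list_kernel_def support subset_iff)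
qed

lemma sum_pmf_inv:
  assumes "\<tau> \<in> orders"
  shows "(\<Sum>k\<in>{1..N}. pmf q (inv \<tau> k)) = 1"
  using sum.permute[OF permutes_inv, of \<tau> "{1..N}" "pmf q"] assms sum_request_pmf
  by (simp add: o_def)

lemma product_form_stationary: "is_stationary N q product_form"
proof -
  have "pmf (bind_pmf product_form (list_kernel q)) \<tau> = pmf product_form \<tau>" for \<tau>
  proof (cases "\<tau> \<in> orders")
    case True
    have "pmf (bind_pmf product_form (list_kernel q)) \<tau>
        = (\<Sum>k\<in>{1..N}. weight \<tau> / total_weight * pmf q (inv \<tau> k))"
      unfolding pmf_step[OF equalityD1[OF set_product_form] True]
    proof (intro sum.cong refl)
      fix k assume k: "k \<in> {1..N}"
      then have "forward_swap k \<circ> \<tau> \<in> orders"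
        using True forward_swap_permutes permutes_compose by blast
      then show "pmf product_form (forward_swap k \<circ> \<tau>) * pmf q (inv (forward_swap k \<circ> \<tau>) k)
          = weight \<tau> / total_weight * pmf q (inv \<tau> k)"
        using weight_forward_swap[OF True k] by (simp add: pmf_product_form)
    qed
    also have "\<dots> = pmf product_form \<tau>"
      using True sum_pmf_inv[OF True]
      by (simp only: sum_distrib_left[symmetric] pmf_product_form) simp
    finally show ?thesis .
  next
    case False
    then have "\<tau> \<notin> set_pmf (bind_pmf product_form (list_kernel q))" 
      using set_step[of product_form] set_product_form by blast
    with False show ?thesis by (simp only: pmf_product_form set_pmf_iff) simp
  qed
  then show ?thesis
    by (auto simp: is_stationary_def set_product_form intro!: pmf_eqI)
qed

text \<open>
  By detailed balance the density \<open>h\<close> of a stationary law with respect to the weight is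
  harmonic: its value at an order is an average, with positive coefficients, of its values at the
  neighbouring orders.  The set of maximisers is therefore closed under all moves, so it is
  everything and \<open>h\<close> is constant.
\<close>

lemma stationary_unique:
  assumes stat: "is_stationary N q \<mu>"
  shows "\<mu> = product_form"
proof -
  have mu: "set_pmf \<mu> \<subseteq> orders" and step: "bind_pmf \<mu> (list_kernel q) = \<mu>"
    using stat by (auto simp: is_stationary_def)
  define h where "h \<sigma> = pmf \<mu> \<sigma> / weight \<sigma>" for \<sigma>
  have mu_h: "pmf \<mu> \<sigma> = h \<sigma> * weight \<sigma>" for \<sigma>
    using weight_pos[of \<sigma>] by (simp add: h_def)
  have moves: "forward_swap k \<circ> \<tau> \<in> orders" if "\<tau> \<in> orders" "k \<in> {1..N}" for \<tau> k
    using that forward_swap_permutes permutes_compose by blast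
  have harmonic: "h \<tau> = (\<Sum>k\<in>{1..N}. pmf q (inv \<tau> k) * h (forward_swap k \<circ> \<tau>))"
    if tau: "\<tau> \<in> orders" for \<tau>
  proof -
    have "h \<tau> * weight \<tau> = pmf (bind_pmf \<mu> (list_kernel q)) \<tau>"
      by (simp add: step mu_h)
    also have "\<dots> = (\<Sum>k\<in>{1..N}. h (forward_swap k \<circ> \<tau>) * (weight \<tau> * pmf q (inv \<tau> k)))"
      unfolding pmf_step[OF mu tau]
      by (intro sum.cong refl) (simp add: mu_h mult.assoc weight_forward_swap[OF tau])
    also have "\<dots> = (\<Sum>k\<in>{1..N}. pmf q (inv \<tau> k) * h (forward_swap k \<circ> \<tau>)) * weight \<tau>"
      by (simp only: sum_distrib_left sum_distrib_right mult_ac)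
    finally show ?thesis using weight_pos[of \<tau>] by simp
  qed
  define M where "M = Max (h ` orders)"
  have le_M: "h \<sigma> \<le> M" if "\<sigma> \<in> orders" for \<sigma>
    unfolding M_def using that by (intro Max_ge) auto
  have "orders \<noteq> {}" using permutes_id by blast
  then have "M \<in> h ` orders"
    unfolding M_def by (intro Max_in) auto
  then obtain \<sigma>\<^sub>0 where max: "\<sigma>\<^sub>0 \<in> orders" "h \<sigma>\<^sub>0 = M" by auto
  define S where "S = {\<sigma> \<in> orders. h \<sigma> = M}"
  have closed: "forward_swap k \<circ> \<tau> \<in> S" if "\<tau> \<in> S" "k \<in> {1..N}" for \<tau> k
  proof -
    have tau: "\<tau> \<in> orders" "h \<tau> = M" using that by (auto simp: S_def)
    have "(\<Sum>k\<in>{1..N}. pmf q (inv \<tau> k) * (M - h (forward_swap k \<circ> \<tau>)))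
        = (\<Sum>k\<in>{1..N}. pmf q (inv \<tau> k)) * M - h \<tau>"
      by (subst harmonic[OF tau(1)])
        (simp only: right_diff_distrib sum_subtractf sum_distrib_right)
    also have "\<dots> = 0" using sum_pmf_inv[OF tau(1)] tau(2) by simp
    finally have "\<forall>k\<in>{1..N}. pmf q (inv \<tau> k) * (M - h (forward_swap k \<circ> \<tau>)) = 0"
      using le_M[OF moves[OF tau(1)]] by (subst (asm) sum_nonneg_eq_0_iff) auto
    moreover have "inv \<tau> k \<in> {1..N}"
      using permutes_in_image[OF permutes_inv, of \<tau> "{1..N}" k] tau that(2) by blast
    ultimately have "h (forward_swap k \<circ> \<tau>) = M"
      using that(2) pmf_pos[of "inv \<tau> k"] by fastforce
    with moves[OF tau(1) that(2)] show ?thesis by (simp add: S_def)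
  qed
  have const: "h \<tau> = M" if "\<tau> \<in> orders" for \<tau>
  proof -
    have s0: "\<sigma>\<^sub>0 permutes {1..N}" using max by simp
    have "\<tau> \<circ> inv \<sigma>\<^sub>0 permutes {1..N}"
      using that by (intro permutes_compose[OF permutes_inv[OF s0]]) simp
    moreover have "\<sigma>\<^sub>0 \<in> S" using max by (simp add: S_def)
    ultimately have "(\<tau> \<circ> inv \<sigma>\<^sub>0) \<circ> \<sigma>\<^sub>0 \<in> S"
      using closed_under_forward_swaps[of S N, OF closed] by blast
    then show ?thesis
      using permutes_inv_o(2)[OF s0] by (simp add: S_def comp_assoc)
  qed
  have zero: "pmf \<mu> \<tau> = 0" if "\<tau> \<notin> orders" for \<tau>
    using mu that by (auto simp: set_pmf_iff)
  have "1 = (\<Sum>\<tau>\<in>orders. pmf \<mu> \<tau>)"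
    using sum_pmf_eq_1[OF finite_orders mu] by simp
  also have "\<dots> = M * total_weight"
    by (simp add: mu_h const total_weight_def sum_distrib_left)
  finally have "M = 1 / total_weight"
    using total_weight_pos by (simp add: field_simps)
  then show ?thesis
    using zero const by (intro pmf_eqI) (simp add: pmf_product_form mu_h split: if_splits)
qed

lemma stationary_distribution_eq: "stationary_distribution N q = product_form"
  unfolding stationary_distribution_def
  using product_form_stationary stationary_unique by (rule the_equality)

end

section \<open>Tail inequalities for the search cost\<close>

lemma prob_eq_sum_pmf:
  assumes "finite S" "set_pmf p \<subseteq> S"
  shows "measure_pmf.prob p A = (\<Sum>a\<in>S. of_bool (a \<in> A) * pmf p a)"
proof -
  have "measure_pmf.prob p A = measure_pmf.prob p (A \<inter> S)"
    using assms(2) by (intro measure_eq_AE) (auto simp: AE_measure_pmf_iff)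
  also have "\<dots> = (\<Sum>a\<in>S. of_bool (a \<in> A) * pmf p a)"
    using assms(1) by (simp add: measure_measure_pmf_finite Int_commute)
  finally show ?thesis .
qed

locale decreasing_requests = request_distribution +
  assumes decreasing: "1 \<le> i \<Longrightarrow> i \<le> j \<Longrightarrow> j \<le> N \<Longrightarrow> pmf q j \<le> pmf q i"
begin

lemma prob_request_gt: "measure_pmf.prob q {x<..} = (\<Sum>i\<in>{x<..N}. pmf q i)"
proof -
  have "measure_pmf.prob q {x<..} = measure_pmf.prob q {x<..N}"
    by (intro measure_eq_AE) (auto simp: AE_measure_pmf_iff support)
  then show ?thesis by (simp add: measure_measure_pmf_finite)
qed

lemma prob_request_gt_pos: "x < N \<Longrightarrow> 0 < measure_pmf.prob q {x<..}"
  using support N_pos by (intro measure_pmf_posI[of N]) auto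

lemma prob_request_gt_less_1:
  assumes "1 \<le> x"
  shows "measure_pmf.prob q {x<..} < 1"
proof -
  have "0 < measure_pmf.prob q {..x}"
    using support N_pos assms by (intro measure_pmf_posI[of 1]) auto
  moreover have "measure_pmf.prob q (UNIV - {..x}) = 1 - measure_pmf.prob q {..x}"
    using measure_pmf.prob_compl[of "{..x}" q] by simp
  moreover have "UNIV - {..x} = {x<..}" by auto
  ultimately show ?thesis by simp
qed

lemma prob_search_cost:
  "measure_pmf.prob (search_cost N q) {x<..}
     = (\<Sum>\<sigma>\<in>orders. pmf product_form \<sigma> * (\<Sum>r\<in>{1..N}. of_bool (x < \<sigma> r) * pmf q r))"
proof -
  have "measure_pmf.prob (search_cost N q) {x<..}
      = (\<Sum>z\<in>orders \<times> {1..N}.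
          of_bool (x < fst z (snd z)) * (pmf product_form (fst z) * pmf q (snd z)))"
    unfolding search_cost_def stationary_distribution_eq measure_map_pmf
    by (subst prob_eq_sum_pmf[where S = "orders \<times> {1..N}"])
      (auto simp: set_product_form support pmf_pair intro!: sum.cong finite_cartesian_product)
  also have "\<dots> = (\<Sum>\<sigma>\<in>orders. \<Sum>r\<in>{1..N}.
      of_bool (x < \<sigma> r) * (pmf product_form \<sigma> * pmf q r))"
    by (subst sum.cartesian_product) (simp add: case_prod_unfold)
  finally show ?thesis by (simp only: sum_distrib_left mult_ac)
qed

lemma prob_product_form:
  "measure_pmf.prob product_form A = (\<Sum>\<sigma>\<in>orders. of_bool (\<sigma> \<in> A) * pmf product_form \<sigma>)"
  by (rule prob_eq_sum_pmf) (auto simp: set_product_form)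

lemma prob_search_cost_by_item:
  "measure_pmf.prob (search_cost N q) {x<..}
     = (\<Sum>r\<in>{1..N}. pmf q r * measure_pmf.prob product_form {\<sigma>. x < \<sigma> r})"
  unfolding prob_search_cost prob_product_form sum_distrib_left mem_Collect_eq
  by (subst sum.swap) (simp only: mult_ac)

text \<open>
  Rearrangement: the items beyond position \<open>x\<close> are as many as the items with label beyond
  \<open>x\<close>.  After cancelling those common to both sets, the rest of the former have labels at most
  \<open>x\<close> and the rest of the latter have labels larger than \<open>x\<close>, so the request probability of
  \<open>x\<close> separates the two.
\<close>

lemma request_gt_le_beyond_position:
  assumes "1 \<le> x" "\<sigma> \<in> orders"
  shows "(\<Sum>r\<in>{x<..N}. pmf q r) \<le> (\<Sum>r\<in>{1..N}. of_bool (x < \<sigma> r) * pmf q r)"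
proof (cases "x < N")
  case False
  then show ?thesis by (simp add: sum_nonneg)
next
  case True
  have s: "\<sigma> permutes {1..N}" using assms by simp
  define A B where "A = {r \<in> {1..N}. x < \<sigma> r}" and "B = {x<..N}"
  have "B = \<sigma> ` A"
  proof
    show "\<sigma> ` A \<subseteq> B"
      using permutes_in_image[OF s] by (fastforce simp: A_def B_def)
    show "B \<subseteq> \<sigma> ` A"
    proof
      fix k assume k: "k \<in> B"
      then have "inv \<sigma> k \<in> {1..N}"
        by (subst permutes_in_image[OF permutes_inv[OF s]]) (simp add: B_def)
      with k have "inv \<sigma> k \<in> A" "\<sigma> (inv \<sigma> k) = k"
        by (simp_all add: A_def B_def permutes_inverses[OF s])
      then show "k \<in> \<sigma> ` A" by (metis imageI)
    qed
  qed
  then have "card A = card B"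
    using permutes_inj_on[OF s] by (metis card_image)
  then have diff: "card (B - A) = card (A - B)"
    using card_Diff_subset_Int[of A B] card_Diff_subset_Int[of B A]
    by (simp add: A_def B_def Int_commute)
  have "(\<Sum>r\<in>B - A. pmf q r) \<le> of_nat (card (B - A)) * pmf q x"
    using assms by (intro sum_bounded_above) (auto simp: B_def intro!: decreasing)
  also have "\<dots> \<le> (\<Sum>r\<in>A - B. pmf q r)"
    unfolding diff using True by (intro sum_bounded_below) (auto simp: A_def B_def intro!: decreasing)
  finally have "(\<Sum>r\<in>B. pmf q r) \<le> (\<Sum>r\<in>A. pmf q r)"
    using sum.Int_Diff[of A "pmf q" B] sum.Int_Diff[of B "pmf q" A]
    by (simp add: A_def B_def Int_commute)
  also have "(\<Sum>r\<in>A. pmf q r) = (\<Sum>r\<in>{1..N}. of_bool (x < \<sigma> r) * pmf q r)"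
    by (subst sum_of_bool_mult_eq) (auto simp: A_def intro!: sum.cong)
  finally show ?thesis by (simp add: B_def)
qed

lemma search_cost_ge_request:
  assumes "1 \<le> x"
  shows "measure_pmf.prob q {x<..} \<le> measure_pmf.prob (search_cost N q) {x<..}"
proof -
  have "measure_pmf.prob q {x<..} 
      = (\<Sum>\<sigma>\<in>orders. pmf product_form \<sigma> * (\<Sum>r\<in>{x<..N}. pmf q r))"
    unfolding prob_request_gt sum_distrib_right[symmetric]
    using sum_pmf_eq_1[of orders product_form] set_product_form by simp
  also have "\<dots> \<le> measure_pmf.prob (search_cost N q) {x<..}"
    unfolding prob_search_cost
    by (intro sum_mono mult_left_mono request_gt_le_beyond_position assms) auto
  finally show ?thesis .
qed

text \<open>
  Exchanging \<open>i\<close> and \<open>j\<close> maps the orders with this inversion injectively into all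
  orders, and divides the weight by at most the claimed factor because the two items are at least
  \<open>m\<close> places apart.
\<close>

lemma prob_far_inversion:
  assumes "1 \<le> i" "i \<le> j" "j \<le> N" "0 < m"
  shows "measure_pmf.prob product_form {\<sigma>. \<sigma> j + m \<le> \<sigma> i} \<le> (pmf q j / pmf q i) ^ m"
proof -
  let ?c = "pmf q j / pmf q i" and ?t = "Transposition.transpose j i"
  have pos: "0 < pmf q i" "0 < pmf q j" using assms by (auto intro!: pmf_pos)
  have c: "0 \<le> ?c" "?c \<le> 1" using pos decreasing assms by auto
  define A where "A = {\<sigma> \<in> orders. \<sigma> j + m \<le> \<sigma> i}"
  have "weight \<sigma> \<le> ?c ^ m * weight (\<sigma> \<circ> ?t)" if "\<sigma> \<in> A" for \<sigma>
  proof -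
    have sigma: "\<sigma> \<in> orders" "\<sigma> j + m \<le> \<sigma> i" using that by (auto simp: A_def)
    have "weight (\<sigma> \<circ> ?t) * pmf q j ^ (\<sigma> i - \<sigma> j) = weight \<sigma> * pmf q i ^ (\<sigma> i - \<sigma> j)"
      using sigma assms by (intro weight_swap) auto
    then have "weight \<sigma> = ?c ^ (\<sigma> i - \<sigma> j) * weight (\<sigma> \<circ> ?t)"
      using pos by (simp add: power_divide field_simps)
    also have "\<dots> \<le> ?c ^ m * weight (\<sigma> \<circ> ?t)"
      using sigma c less_imp_le[OF weight_pos] by (intro mult_right_mono power_decreasing) auto
    finally show ?thesis .
  qed
  then have "(\<Sum>\<sigma>\<in>A. weight \<sigma>) \<le> ?c ^ m * (\<Sum>\<sigma>\<in>A. weight (\<sigma> \<circ> ?t))"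
    unfolding sum_distrib_left by (rule sum_mono)
  also have "(\<Sum>\<sigma>\<in>A. weight (\<sigma> \<circ> ?t)) = (\<Sum>\<sigma>\<in>(\<lambda>\<sigma>. \<sigma> \<circ> ?t) ` A. weight \<sigma>)"
  proof (subst sum.reindex)
    show "inj_on (\<lambda>\<sigma>. \<sigma> \<circ> ?t) A"
      by (rule inj_on_inverseI[where g = "\<lambda>\<sigma>. \<sigma> \<circ> ?t"]) (simp add: comp_assoc)
  qed simp
  also have "\<dots> \<le> total_weight"
    unfolding total_weight_def
  proof (rule sum_mono2)
    have "?t permutes {1..N}" using assms by (intro permutes_swap_id) auto
    then show "(\<lambda>\<sigma>. \<sigma> \<circ> ?t) ` A \<subseteq> orders"
      by (auto simp: A_def intro: permutes_compose)
  qed (simp_all add: less_imp_le[OF weight_pos])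
  finally have "(\<Sum>\<sigma>\<in>A. weight \<sigma>) \<le> ?c ^ m * total_weight"
    using c by (simp add: mult_left_mono)
  moreover have "measure_pmf.prob product_form {\<sigma>. \<sigma> j + m \<le> \<sigma> i} = (\<Sum>\<sigma>\<in>A. weight \<sigma>) / total_weight"
    unfolding prob_product_form A_def sum_divide_distrib
    by (subst sum.inter_filter) (auto simp: pmf_product_form intro!: sum.cong)
  ultimately show ?thesis
    using total_weight_pos by (simp add: pos_divide_le_eq)
qed

text \<open>
  Pigeonhole: otherwise the first \<open>x - d\<close> positions would be filled by the items
  \<open>1, \<dots>, x - d\<close> themselves, leaving no room for \<open>i\<close> beyond position \<open>x\<close>.
\<close>

lemma late_item_overtaken:
  assumes "\<sigma> \<in> orders" "1 \<le> i" "i \<le> x - d" "x < \<sigma> i"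
  shows "\<exists>j\<in>{x - d<..N}. \<sigma> j + Suc d \<le> \<sigma> i"
proof (rule ccontr)
  assume none: "\<not> ?thesis"
  have s: "\<sigma> permutes {1..N}" using assms by simp
  have "\<sigma> i \<in> {1..N}" 
    using assms permutes_not_in[OF s, of i] permutes_in_image[OF s, of i] by fastforce
  then have x: "x < N" using assms by simp
  have "inv \<sigma> ` {1..x - d} \<subseteq> {1..x - d}"
  proof safe
    fix k assume k: "k \<in> {1..x - d}"
    then have "inv \<sigma> k \<in> {1..N}"
      using x permutes_in_image[OF permutes_inv[OF s], of k] by auto
    moreover have "\<sigma> (inv \<sigma> k) = k" by (rule permutes_inverses[OF s])
    moreover have "k + Suc d \<le> \<sigma> i" using k assms by auto
    ultimately show "inv \<sigma> k \<in> {1..x - d}"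
      using none by (metis atLeastAtMost_iff greaterThanAtMost_iff not_le)
  qed
  then have "inv \<sigma> ` {1..x - d} = {1..x - d}"
    using permutes_inj_on[OF permutes_inv[OF s]] by (intro endo_inj_surj) auto
  then obtain k where "k \<in> {1..x - d}" "i = inv \<sigma> k"
    using assms(2,3) by (metis atLeastAtMost_iff imageE)
  then have "\<sigma> i \<le> x - d" by (simp add: permutes_inverses[OF s])
  with assms(4) show False by simp
qed

text \<open>
  Requests beyond \<open>y\<close> are bounded trivially.  For an item \<open>i \<le> y\<close>, the union bound over the
  overtaking items \<open>j > x - d\<close> gives terms \<open>q\<^sub>i (q\<^sub>j / q\<^sub>i)\<^sup>d\<^sup>+\<^sup>1 = q\<^sub>j (q\<^sub>j / q\<^sub>i)\<^sup>d\<close>.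
  One factor of the inversion bound thus turns \<open>q\<^sub>i\<close> into \<open>q\<^sub>j\<close>, whose sum is a tail, and the
  remaining \<open>d\<close> factors are a gain.
\<close>

lemma search_cost_le:
  assumes "1 \<le> y" "y \<le> x - d" "x \<le> N"
  shows "measure_pmf.prob (search_cost N q) {x<..} \<le> measure_pmf.prob q {y<..}
     + real y * (pmf q (x - d) / pmf q y) ^ d * measure_pmf.prob q {x - d<..}"
proof -
  let ?c = "(pmf q (x - d) / pmf q y) ^ d"
  let ?late = "\<lambda>i. measure_pmf.prob product_form {\<sigma>. x < \<sigma> i}"
  have item: "pmf q i * ?late i \<le> ?c * measure_pmf.prob q {x - d<..}" if "i \<in> {1..y}" for i
  proof -
    have i: "1 \<le> i" "i \<le> y" using that by auto
    have pos: "0 < pmf q i" "0 < pmf q y" using i assms by (auto intro!: pmf_pos)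
    have "?late i \<le> measure_pmf.prob product_form (\<Union>j\<in>{x - d<..N}. {\<sigma>. \<sigma> j + Suc d \<le> \<sigma> i})"
      using late_item_overtaken[of _ i x d] i assms
      by (intro measure_pmf.finite_measure_mono_AE) (auto simp: AE_measure_pmf_iff set_product_form)
    also have "\<dots> \<le> (\<Sum>j\<in>{x - d<..N}. measure_pmf.prob product_form {\<sigma>. \<sigma> j + Suc d \<le> \<sigma> i})"
      by (intro measure_pmf.finite_measure_subadditive_finite) auto
    also have "\<dots> \<le> (\<Sum>j\<in>{x - d<..N}. (pmf q j / pmf q i) ^ Suc d)"
      using i assms by (intro sum_mono prob_far_inversion) auto
    finally have "pmf q i * ?late i \<le> (\<Sum>j\<in>{x - d<..N}. pmf q i * (pmf q j / pmf q i) ^ Suc d)"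
      unfolding sum_distrib_left[symmetric] using pos by (intro mult_left_mono) auto
    also have "\<dots> \<le> (\<Sum>j\<in>{x - d<..N}. ?c * pmf q j)"
    proof (intro sum_mono)
      fix j assume j: "j \<in> {x - d<..N}"
      have "(pmf q j / pmf q i) ^ d \<le> ?c"
        using i j assms pos by (intro power_mono frac_le decreasing) auto
      then show "pmf q i * (pmf q j / pmf q i) ^ Suc d \<le> ?c * pmf q j"
        using pos mult_left_mono[of "(pmf q j / pmf q i) ^ d" ?c "pmf q j"]
        by (simp add: mult.commute)
    qed
    finally show ?thesis by (simp add: prob_request_gt sum_distrib_left)
  qed
  have "{1..N} = {1..y} \<union> {y<..N}" using assms by auto
  then have "measure_pmf.prob (search_cost N q) {x<..}
      = (\<Sum>i\<in>{1..y}. pmf q i * ?late i) + (\<Sum>i\<in>{y<..N}. pmf q i * ?late i)"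
    unfolding prob_search_cost_by_item by (simp only:, intro sum.union_disjoint) auto
  also have "\<dots> \<le> (\<Sum>i\<in>{1..y}. ?c * measure_pmf.prob q {x - d<..}) + (\<Sum>i\<in>{y<..N}. pmf q i)"
    by (intro add_mono sum_mono item) (auto intro: mult_left_le)
  finally show ?thesis by (simp add: prob_request_gt mult.assoc)
qed

end

section \<open>Truncations and the reduction of the limit to an upper bound\<close>

lemma nonincreasing_distribution_positive:
  assumes "nonincreasing_distribution \<pi>"
  shows "0 < pmf \<pi> 1"
proof -
  obtain i where i: "i \<in> set_pmf \<pi>" using set_pmf_not_empty[of \<pi>] by blast
  then have "1 \<le> i" using assms by (auto simp: nonincreasing_distribution_def)
  then have "pmf \<pi> i \<le> pmf \<pi> 1" using assms by (simp add: nonincreasing_distribution_def)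
  with i show ?thesis by (simp add: pmf_positive_iff[symmetric])
qed

locale positive_decreasing_distribution =
  fixes \<pi> :: "nat pmf"
  assumes nonincreasing: "nonincreasing_distribution \<pi>"
    and positive: "\<And>i. 1 \<le> i \<Longrightarrow> 0 < pmf \<pi> i"
begin

lemma set_pmf_eq: "set_pmf \<pi> = {1..}"
  using nonincreasing positive
  by (fastforce simp: nonincreasing_distribution_def set_pmf_iff)

lemma pmf_decreasing: "1 \<le> i \<Longrightarrow> i \<le> j \<Longrightarrow> pmf \<pi> j \<le> pmf \<pi> i"
  using nonincreasing by (simp add: nonincreasing_distribution_def)

lemma truncation_mass:
  assumes "1 \<le> N"
  shows "pmf \<pi> 1 \<le> measure_pmf.prob \<pi> {..N}" "measure_pmf.prob \<pi> {..N} \<le> 1"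
proof -
  have "measure_pmf.prob \<pi> {1} \<le> measure_pmf.prob \<pi> {..N}"
    using assms by (intro measure_pmf.finite_measure_mono) auto
  then show "pmf \<pi> 1 \<le> measure_pmf.prob \<pi> {..N}" by (simp add: measure_pmf_single)
qed simp

lemma
  assumes "1 \<le> N"
  shows pmf_truncated:
      "pmf (truncated \<pi> N) i = (if i \<le> N then pmf \<pi> i / measure_pmf.prob \<pi> {..N} else 0)"
    and set_truncated: "set_pmf (truncated \<pi> N) = {1..N}"
proof -
  have "set_pmf \<pi> \<inter> {..N} \<noteq> {}" using assms by (auto simp: set_pmf_eq)
  then show "pmf (truncated \<pi> N) i = (if i \<le> N then pmf \<pi> i / measure_pmf.prob \<pi> {..N} else 0)"
    and "set_pmf (truncated \<pi> N) = {1..N}"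
    by (auto simp: truncated_def pmf_cond set_pmf_eq)
qed

lemma decreasing_requests_truncated:
  assumes "1 \<le> N"
  shows "decreasing_requests N (truncated \<pi> N)"
  by standard
    (auto simp: set_truncated[OF assms] pmf_truncated[OF assms] intro!: divide_right_mono pmf_decreasing)

lemma prob_truncated_gt:
  assumes "1 \<le> N"
  shows "measure_pmf.prob (truncated \<pi> N) {x<..}
      = (\<Sum>i\<in>{x<..N}. pmf \<pi> i) / measure_pmf.prob \<pi> {..N}"
  unfolding decreasing_requests.prob_request_gt[OF decreasing_requests_truncated[OF assms]]
  by (simp add: pmf_truncated[OF assms] sum_divide_distrib)

lemma prob_truncated_gt_le:
  assumes "1 \<le> N"
  shows "measure_pmf.prob (truncated \<pi> N) {x<..} \<le> (\<Sum>i\<in>{x<..N}. pmf \<pi> i) / pmf \<pi> 1"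
  unfolding prob_truncated_gt[OF assms]
  using truncation_mass[OF assms] positive[of 1] by (intro divide_left_mono sum_nonneg) auto

lemma prob_truncated_gt_ge:
  assumes "1 \<le> N"
  shows "(\<Sum>i\<in>{x<..N}. pmf \<pi> i) \<le> measure_pmf.prob (truncated \<pi> N) {x<..}"
  unfolding prob_truncated_gt[OF assms]
  using truncation_mass[OF assms] positive[of 1] sum_nonneg[of "{x<..N}" "pmf \<pi>"]
  by (simp add: pos_le_divide_eq mult_left_le)

text \<open>
  The ratio of logarithms never exceeds 1 because the search cost dominates the request, and
  logarithms of probabilities are negative; the constraint \<open>x < N\<close> keeps both probabilities
  positive, so that these are genuine logarithms.  Hence only the upper bound on the search cost is left
  to the individual cases.
\<close>

lemma log_tail_ratio_tendsto_1:
  assumes constraint: "\<And>x N. P x N \<Longrightarrow> 1 \<le> x \<Longrightarrow> 1 \<le> N \<Longrightarrow> x < N"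
    and upper: "\<And>\<epsilon>. 0 < \<epsilon> \<Longrightarrow> \<epsilon> < 1 \<Longrightarrow>
      \<forall>\<^sub>F x in sequentially. \<forall>N. 1 \<le> N \<longrightarrow> P x N \<longrightarrow>
        measure_pmf.prob (search_cost N (truncated \<pi> N)) {x<..}
          \<le> measure_pmf.prob (truncated \<pi> N) {x<..} powr (1 - \<epsilon>)"
  shows "(log_tail_ratio \<pi> \<longlongrightarrow> 1) (joint_at_top P)"
proof (rule tendstoI)
  fix e :: real assume e: "0 < e"
  define \<epsilon> where "\<epsilon> = min e 1 / 2"
  have eps: "0 < \<epsilon>" "\<epsilon> < 1" "\<epsilon> < e" using e by (auto simp: \<epsilon>_def)
  obtain X where X: "\<And>x N. X \<le> x \<Longrightarrow> 1 \<le> N \<Longrightarrow> P x N \<Longrightarrow>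
        measure_pmf.prob (search_cost N (truncated \<pi> N)) {x<..}
          \<le> measure_pmf.prob (truncated \<pi> N) {x<..} powr (1 - \<epsilon>)"
    using upper[OF eps(1,2)] by (auto simp: eventually_sequentially)
  have "dist (log_tail_ratio \<pi> (x, N)) 1 < e" if xN: "max X 1 \<le> x" "max X 1 \<le> N" "P x N" for x N
  proof -
    have x: "1 \<le> x" "1 \<le> N" "x < N" using xN constraint[of x N] by auto
    interpret decreasing_requests N "truncated \<pi> N"
      by (rule decreasing_requests_truncated[OF x(2)])
    define T where "T = measure_pmf.prob (truncated \<pi> N) {x<..}"
    define C where "C = measure_pmf.prob (search_cost N (truncated \<pi> N)) {x<..}"
    have T: "0 < T" "T < 1"
      using prob_request_gt_pos[OF x(3)] prob_request_gt_less_1[OF x(1)] by (auto simp: T_def)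
    have C: "T \<le> C" "C \<le> T powr (1 - \<epsilon>)"
      using search_cost_ge_request[OF x(1)] X[of x N] xN x by (auto simp: T_def C_def)
    have "ln T < 0" using T by simp
    moreover have "ln T \<le> ln C" using T C by simp
    moreover have "ln C \<le> (1 - \<epsilon>) * ln T"
      using T C by (metis ln_mono ln_powr less_le_trans less_irrefl)
    ultimately have "1 - \<epsilon> \<le> ln C / ln T" "ln C / ln T \<le> 1"
      by (simp_all add: neg_le_divide_eq neg_divide_le_eq)
    then show ?thesis
      using eps by (simp add: log_tail_ratio_def T_def C_def dist_real_def)
  qed
  then have "\<forall>x\<ge>max X 1. \<forall>N\<ge>max X 1. P x N \<longrightarrow> dist (log_tail_ratio \<pi> (x, N)) 1 < e" by blast
  then show "\<forall>\<^sub>F z in joint_at_top P. dist (log_tail_ratio \<pi> z) 1 < e"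
    unfolding joint_at_top_def eventually_inf_principal eventually_prod_sequentially
    by (intro exI[of _ "max X 1"]) auto
qed

end

section \<open>Asymptotically geometric distributions\<close>

lemma sum_le_telescope:
  fixes f g :: "nat \<Rightarrow> real"
  assumes "\<And>i. y < i \<Longrightarrow> f i \<le> g (i - 1) - g i" "\<And>i. 0 \<le> g i"
  shows "(\<Sum>i\<in>{y<..n}. f i) \<le> g y"
proof (cases "y \<le> n")
  case True
  then have "(\<Sum>i\<in>{y<..n}. f i) \<le> g y - g n"
  proof (induction n rule: dec_induct)
    case (step n)
    have "{y<..Suc n} = insert (Suc n) {y<..n}" using step by auto
    then show ?case using step assms(1)[of "Suc n"] by simp
  qed simp
  with assms(2)[of n] show ?thesis by simp
qed (use assms(2) in simp)

text \<open>
  The request tail is at most a constant times \<open>\<rho>\<close> to the power \<open>x\<close> for some \<open>\<rho> < 1\<close>,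
  so an arbitrarily small power of it absorbs the factor \<open>1 + x\<close> between the two tails.
\<close>

lemma asymptotically_geometric_limit:
  assumes nonincr: "nonincreasing_distribution \<pi>" and geom: "asymptotically_geometric \<nu> \<pi>"
  shows "(log_tail_ratio \<pi> \<longlongrightarrow> 1) (joint_at_top (\<lambda>x N. x < N))"
proof -
  have nu: "0 < \<nu>" "\<nu> < 1" and lim: "(\<lambda>i. ln (pmf \<pi> i) / real i) \<longlonglongrightarrow> ln \<nu>"
    using geom by (auto simp: asymptotically_geometric_def)
  \<comment> \<open>any number strictly between \<open>\<nu>\<close> and 1 would serve\<close>
  define \<rho> where "\<rho> = sqrt \<nu>"
  have rho: "0 < \<rho>" "\<rho> < 1" using nu by (auto simp: \<rho>_def)
  have "ln \<nu> < ln \<rho>" using nu by (simp add: \<rho>_def ln_sqrt)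
  then have "\<forall>\<^sub>F i in sequentially. ln (pmf \<pi> i) / real i < ln \<rho>"
    using lim by (intro order_tendstoD)
  then obtain I where I: "\<And>i. I \<le> i \<Longrightarrow> ln (pmf \<pi> i) / real i < ln \<rho>"
    by (auto simp: eventually_sequentially)
  have large: "0 < pmf \<pi> i \<and> pmf \<pi> i \<le> \<rho> ^ i" if "I \<le> i" "1 \<le> i" for i
  proof -
    have less: "ln (pmf \<pi> i) < ln \<rho> * real i"
      using I[OF that(1)] that(2) by (simp add: pos_divide_less_eq)
    also have "\<dots> < 0" using rho that(2) by (simp add: mult_neg_pos)
    \<comment> \<open>a vanishing point mass would have logarithm 0 instead of a negative one\<close>
    finally have pos: "0 < pmf \<pi> i"
      using pmf_nonneg[of \<pi> i] by (cases "pmf \<pi> i = 0") auto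
    have "ln (pmf \<pi> i) \<le> ln (\<rho> ^ i)" using less rho by (simp add: ln_realpow mult.commute)
    with pos rho show ?thesis by simp
  qed
  interpret positive_decreasing_distribution \<pi>
  proof
    fix i :: nat assume "1 \<le> i"
    then have "pmf \<pi> (max I i) \<le> pmf \<pi> i"
      using nonincr by (simp add: nonincreasing_distribution_def)
    moreover have "0 < pmf \<pi> (max I i)" using large[of "max I i"] \<open>1 \<le> i\<close> by simp
    ultimately show "0 < pmf \<pi> i" by linarith
  qed (rule nonincr)
  define K where "K = 1 / ((1 - \<rho>) * pmf \<pi> 1)"
  have K: "0 < K" using rho positive[of 1] by (simp add: K_def)
  have tail: "measure_pmf.prob (truncated \<pi> N) {x<..} \<le> K * \<rho> ^ x" if "I \<le> x" "1 \<le> N" for x N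
  proof -
    have "(\<Sum>i\<in>{x<..N}. pmf \<pi> i) \<le> (\<Sum>i\<in>{x<..N}. \<rho> ^ i)"
      using large that by (intro sum_mono) auto
    also have "\<dots> \<le> \<rho> ^ x / (1 - \<rho>)"
    proof (rule sum_le_telescope[where g = "\<lambda>i. \<rho> ^ i / (1 - \<rho>)"])
      fix i assume "x < i"
      then obtain k where k: "i = Suc k" by (cases i) auto
      have "\<rho> ^ (i - 1) / (1 - \<rho>) - \<rho> ^ i / (1 - \<rho>) = \<rho> ^ k"
        unfolding diff_divide_distrib[symmetric] using rho
        by (subst nonzero_divide_eq_eq) (auto simp: k algebra_simps)
      also have "\<rho> ^ i \<le> \<dots>" using rho by (simp add: k mult_left_le_one_le)
      finally show "\<rho> ^ i \<le> \<rho> ^ (i - 1) / (1 - \<rho>) - \<rho> ^ i / (1 - \<rho>)" .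
    qed (use rho in simp)
    finally have "(\<Sum>i\<in>{x<..N}. pmf \<pi> i) / pmf \<pi> 1 \<le> \<rho> ^ x / (1 - \<rho>) / pmf \<pi> 1"
      by (rule divide_right_mono) simp
    also have "\<dots> = K * \<rho> ^ x" by (simp add: K_def)
    finally have "(\<Sum>i\<in>{x<..N}. pmf \<pi> i) / pmf \<pi> 1 \<le> K * \<rho> ^ x" .
    with prob_truncated_gt_le[OF that(2)] show ?thesis by (rule order_trans)
  qed
  show ?thesis
  proof (rule log_tail_ratio_tendsto_1)
    fix \<epsilon> :: real assume eps: "0 < \<epsilon>" "\<epsilon> < 1"
    define c where "c = - \<epsilon> * ln \<rho>"
    have c: "0 < c" using eps rho by (simp add: c_def mult_pos_neg)
    have power: "(K * \<rho> ^ x) powr \<epsilon> = K powr \<epsilon> * exp (- c * real x)" for x :: nat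
      using K rho by (simp add: powr_mult powr_def ln_mult ln_realpow c_def exp_add[symmetric] algebra_simps)
    have "(\<lambda>x. (1 + real x) * (K powr \<epsilon> * exp (- c * real x))) \<longlonglongrightarrow> 0"
      using c by real_asymp
    then have "\<forall>\<^sub>F x in sequentially. (1 + real x) * (K powr \<epsilon> * exp (- c * real x)) < 1"
      by (rule order_tendstoD) simp
    moreover have "\<forall>\<^sub>F x in sequentially. max I 1 \<le> x" by (rule eventually_ge_at_top)
    ultimately show "\<forall>\<^sub>F x in sequentially. \<forall>N. 1 \<le> N \<longrightarrow> x < N \<longrightarrow>
        measure_pmf.prob (search_cost N (truncated \<pi> N)) {x<..}
          \<le> measure_pmf.prob (truncated \<pi> N) {x<..} powr (1 - \<epsilon>)"
    proof eventually_elim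
      case (elim x)
      show ?case
      proof (intro allI impI)
        fix N :: nat assume N: "1 \<le> N" "x < N"
        interpret decreasing_requests N "truncated \<pi> N"
          by (rule decreasing_requests_truncated[OF N(1)])
        let ?T = "measure_pmf.prob (truncated \<pi> N) {x<..}"
        have T: "0 < ?T" by (rule prob_request_gt_pos[OF N(2)])
        have "?T powr \<epsilon> \<le> (K * \<rho> ^ x) powr \<epsilon>"
          using T tail[of x N] elim N eps by (intro powr_mono2) auto
        then have "(1 + real x) * ?T powr \<epsilon> \<le> (1 + real x) * (K * \<rho> ^ x) powr \<epsilon>"
          by (intro mult_left_mono) auto
        with elim have le1: "(1 + real x) * ?T powr \<epsilon> \<le> 1" by (simp only: power)
        have "measure_pmf.prob (search_cost N (truncated \<pi> N)) {x<..} \<le> (1 + real x) * ?T"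
          using search_cost_le[of x x 0] elim N by (simp add: algebra_simps)
        also have "\<dots> = ((1 + real x) * ?T powr \<epsilon>) * ?T powr (1 - \<epsilon>)"
          using T by (simp add: powr_add[symmetric])
        also have "\<dots> \<le> 1 * ?T powr (1 - \<epsilon>)"
          using le1 by (intro mult_right_mono) auto
        finally show "measure_pmf.prob (search_cost N (truncated \<pi> N)) {x<..} \<le> ?T powr (1 - \<epsilon>)"
          by simp
      qed
    qed
  qed
qed

section \<open>Power laws\<close>

text \<open>
  The increment of the antiderivative over \<open>[k, k + 1]\<close> is a value of the decreasing
  integrand on that interval.
\<close>

lemma powr_minus_le_telescope:
  fixes \<alpha> :: real
  assumes "1 < \<alpha>" "1 \<le> k"
  shows "real (Suc k) powr (-\<alpha>)
      \<le> real k powr (1 - \<alpha>) / (\<alpha> - 1) - real (Suc k) powr (1 - \<alpha>) / (\<alpha> - 1)"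
proof -
  let ?g = "\<lambda>t::real. t powr (1 - \<alpha>) / (1 - \<alpha>)"
  have "\<exists>z. real k < z \<and> z < real (Suc k) \<and>
      ?g (real (Suc k)) - ?g (real k) = (real (Suc k) - real k) * z powr (-\<alpha>)"
  proof (rule MVT2)
    fix t assume "real k \<le> t" "t \<le> real (Suc k)"
    then have "0 < t" using assms by simp
    then show "(?g has_real_derivative t powr (-\<alpha>)) (at t)"
      using DERIV_cdivide[OF has_real_derivative_powr, of t "1 - \<alpha>" "1 - \<alpha>"] assms by simp
  qed simp
  then obtain z where z: "real k < z" "z < real (Suc k)"
    "?g (real (Suc k)) - ?g (real k) = z powr (-\<alpha>)" by auto
  have "real (Suc k) powr (-\<alpha>) \<le> z powr (-\<alpha>)"
    using z assms by (intro powr_mono2') auto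
  also have "\<dots> = real k powr (1 - \<alpha>) / (\<alpha> - 1) - real (Suc k) powr (1 - \<alpha>) / (\<alpha> - 1)"
    unfolding z(3)[symmetric] using assms by (simp add: divide_simps) (simp add: algebra_simps)
  finally show ?thesis .
qed

locale power_law_distribution = positive_decreasing_distribution +
  fixes \<alpha> :: real
  assumes exponent: "1 < \<alpha>"
    and pmf_power: "\<And>i. 1 \<le> i \<Longrightarrow> pmf \<pi> i = pmf \<pi> 1 * real i powr (-\<alpha>)"
begin

lemma prob_truncated_gt_upper:
  assumes "1 \<le> N" "1 \<le> y"
  shows "measure_pmf.prob (truncated \<pi> N) {y<..} \<le> real y powr (1 - \<alpha>) / (\<alpha> - 1)"
proof -
  have "(\<Sum>i\<in>{y<..N}. pmf \<pi> i) / pmf \<pi> 1 = (\<Sum>i\<in>{y<..N}. real i powr (-\<alpha>))"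
    unfolding sum_divide_distrib
  proof (intro sum.cong refl)
    fix i assume "i \<in> {y<..N}"
    then show "pmf \<pi> i / pmf \<pi> 1 = real i powr (-\<alpha>)"
      using pmf_power[of i] positive[of 1] by simp
  qed
  also have "\<dots> \<le> real y powr (1 - \<alpha>) / (\<alpha> - 1)"
  proof (rule sum_le_telescope[where g = "\<lambda>i. real i powr (1 - \<alpha>) / (\<alpha> - 1)"])
    fix i assume "y < i"
    then show "real i powr (-\<alpha>) \<le> real (i - 1) powr (1 - \<alpha>) / (\<alpha> - 1) - real i powr (1 - \<alpha>) / (\<alpha> - 1)"
      using powr_minus_le_telescope[OF exponent, of "i - 1"] assms by simp
  qed (use exponent in simp)
  finally show ?thesis using prob_truncated_gt_le[OF assms(1), of y] by linarith
qed

text \<open>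
  The constraint leaves at least a fixed multiple of \<open>x\<close> items between \<open>x\<close> and
  \<open>min N (2 x)\<close>, and each of them has a probability of order \<open>x\<close> to the power
  \<open>- \<alpha>\<close>.
\<close>

lemma prob_truncated_gt_lower:
  assumes "1 \<le> x" "1 \<le> N" "real x / real N < \<gamma>" "\<gamma> < 1"
  shows "pmf \<pi> 1 * min 1 (1 / \<gamma> - 1) * 2 powr (-\<alpha>) * real x powr (1 - \<alpha>)
      \<le> measure_pmf.prob (truncated \<pi> N) {x<..}"
proof -
  let ?M = "min N (2 * x)" and ?\<kappa> = "min 1 (1 / \<gamma> - 1)"
  have gamma: "0 < \<gamma>" using assms by (smt (verit) divide_nonneg_nonneg of_nat_0_le_iff)
  have "real x / \<gamma> < real N" using assms gamma by (simp add: field_simps)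
  moreover have "?\<kappa> * real x \<le> 1 * real x" "?\<kappa> * real x \<le> (1 / \<gamma> - 1) * real x"
    by (intro mult_right_mono; simp)+
  ultimately have count: "?\<kappa> * real x \<le> real ?M - real x"
    by (simp add: algebra_simps min_def)
  moreover have "0 \<le> ?\<kappa> * real x" using gamma assms by simp
  ultimately have "x \<le> ?M" by simp
  then have card: "real (card {x<..?M}) = real ?M - real x" by (simp add: of_nat_diff)
  have x2: "(2 * real x) powr (-\<alpha>) * real x = 2 powr (-\<alpha>) * real x powr (1 - \<alpha>)"
    using assms(1) by (simp add: powr_mult powr_diff powr_minus field_simps)
  have "pmf \<pi> 1 * ?\<kappa> * 2 powr (-\<alpha>) * real x powr (1 - \<alpha>)
      = (?\<kappa> * real x) * (pmf \<pi> 1 * (2 * real x) powr (-\<alpha>))"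
    using x2 by (simp add: mult_ac)
  also have "\<dots> \<le> of_nat (card {x<..?M}) * (pmf \<pi> 1 * (2 * real x) powr (-\<alpha>))"
    unfolding card using count by (intro mult_right_mono) auto
  also have "\<dots> \<le> (\<Sum>i\<in>{x<..?M}. pmf \<pi> i)"
  proof (rule sum_bounded_below)
    fix i assume i: "i \<in> {x<..?M}"
    then have "(2 * real x) powr (-\<alpha>) \<le> real i powr (-\<alpha>)"
      using exponent assms(1) by (intro powr_mono2') auto
    with i show "pmf \<pi> 1 * (2 * real x) powr (-\<alpha>) \<le> pmf \<pi> i"
      using pmf_power[of i] by (simp add: mult_left_mono)
  qed
  also have "\<dots> \<le> (\<Sum>i\<in>{x<..N}. pmf \<pi> i)"
    by (intro sum_mono2) auto
  finally show ?thesis using prob_truncated_gt_ge[OF assms(2), of x] by linarith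
qed

text \<open>
  This is the tail inequality with \<open>y\<close> of order \<open>x powr (1 - \<epsilon>)\<close>.  The tail of the requests
  beyond \<open>y\<close> has the claimed size.  The ratio \<open>q\<^sub>x\<^sub>-\<^sub>d / q\<^sub>y\<close> is of order
  \<open>x powr (- \<epsilon> * \<alpha>)\<close>, and raising it to a power \<open>d\<close> with \<open>\<epsilon> d \<ge> 1\<close> leaves a second
  summand of order at most \<open>x powr (1 - \<alpha>)\<close>, which is smaller.
\<close>

lemma search_cost_upper:
  assumes "0 < \<epsilon>" "\<epsilon> < 1"
  shows "\<exists>A>0. \<forall>\<^sub>F x in sequentially. \<forall>N. x < N \<longrightarrow>
    measure_pmf.prob (search_cost N (truncated \<pi> N)) {x<..} \<le> A * real x powr ((1 - \<epsilon>) * (1 - \<alpha>))"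
proof -
  define d where "d = nat \<lceil>1 / \<epsilon>\<rceil>"
  have d: "1 \<le> \<epsilon> * real d"
    using assms real_nat_ceiling_ge[of "1 / \<epsilon>"]
    by (simp only: d_def[symmetric] pos_divide_le_eq mult.commute)
  define A where "A = 1 / (\<alpha> - 1) + 4 powr (\<alpha> * real d)"
  have "\<forall>\<^sub>F x in sequentially. real x powr (1 - \<epsilon>) + 1 \<le> real x - real d"
    using assms by real_asymp
  moreover have "\<forall>\<^sub>F x in sequentially. real x / 2 \<le> real x - real d" by real_asymp
  moreover have "\<forall>\<^sub>F x in sequentially. 1 \<le> x" by (rule eventually_ge_at_top)
  ultimately have "\<forall>\<^sub>F x in sequentially. \<forall>N. x < N \<longrightarrow>
    measure_pmf.prob (search_cost N (truncated \<pi> N)) {x<..} \<le> A * real x powr ((1 - \<epsilon>) * (1 - \<alpha>))"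
  proof eventually_elim
    case (elim x)
    show ?case
    proof (intro allI impI)
      fix N assume xN: "x < N"
      then have N: "1 \<le> N" by simp
      interpret decreasing_requests N "truncated \<pi> N"
        by (rule decreasing_requests_truncated[OF N])
      let ?b = "real x powr ((1 - \<epsilon>) * (1 - \<alpha>))"
      define y where "y = nat \<lceil>real x powr (1 - \<epsilon>)\<rceil>"
      have root: "1 \<le> real x powr (1 - \<epsilon>)"
        using elim assms by (intro ge_one_powr_ge_zero) auto
      have y_ge: "real x powr (1 - \<epsilon>) \<le> real y"
        unfolding y_def by (rule real_nat_ceiling_ge)
      have y_le: "real y \<le> real x powr (1 - \<epsilon>) + 1"
        using root unfolding y_def by simp
      have y1: "1 \<le> y" using root y_ge by linarith
      have dx: "d \<le> x" using elim(1) root by linarith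
      then have xd: "real (x - d) = real x - real d" by (simp add: of_nat_diff)
      have yx: "y \<le> x - d" using y_le elim(1) xd by linarith
      then have "x - d \<le> N" "y \<le> N" using xN by auto
      have head: "measure_pmf.prob (truncated \<pi> N) {y<..} \<le> 1 / (\<alpha> - 1) * ?b"
      proof -
        have "real y powr (1 - \<alpha>) \<le> (real x powr (1 - \<epsilon>)) powr (1 - \<alpha>)"
          using y_ge root exponent elim(3) by (intro powr_mono2') auto
        then have "real y powr (1 - \<alpha>) / (\<alpha> - 1) \<le> ?b / (\<alpha> - 1)"
          using exponent by (simp add: powr_powr divide_right_mono)
        with prob_truncated_gt_upper[OF N y1] show ?thesis by simp
      qed
      have "pmf (truncated \<pi> N) (x - d) / pmf (truncated \<pi> N) y = (real y / real (x - d)) powr \<alpha>"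
        using y1 yx xN \<open>x - d \<le> N\<close> \<open>y \<le> N\<close> positive[of 1] truncation_mass[OF N]
        by (simp add: pmf_truncated[OF N] pmf_power[of y] pmf_power[of "x - d"] powr_minus
            powr_divide field_simps)
      also have "\<dots> \<le> (4 * real x powr (-\<epsilon>)) powr \<alpha>"
      proof (intro powr_mono2)
        have "real y \<le> 2 * real x powr (1 - \<epsilon>)" using y_le root by linarith
        then have "real y / real (x - d) \<le> (2 * real x powr (1 - \<epsilon>)) / (real x / 2)"
          using elim xd by (intro frac_le) auto
        also have "\<dots> = 4 * real x powr (-\<epsilon>)"
          using elim(3) by (simp add: powr_diff powr_minus field_simps)
        finally show "real y / real (x - d) \<le> 4 * real x powr (-\<epsilon>)" .
      qed (use exponent in auto)
      finally have "(pmf (truncated \<pi> N) (x - d) / pmf (truncated \<pi> N) y) ^ d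
          \<le> ((4 * real x powr (-\<epsilon>)) powr \<alpha>) ^ d"
        by (intro power_mono) auto
      also have "\<dots> = 4 powr (\<alpha> * real d) * real x powr (-(\<alpha> * (\<epsilon> * real d)))"
        using elim(3) by (simp add: powr_mult powr_powr powr_power power_mult_distrib mult_ac)
      also have "\<dots> \<le> 4 powr (\<alpha> * real d) * real x powr (-\<alpha>)"
        using d exponent elim(3) by (intro mult_left_mono powr_mono) auto
      finally have ratio: "(pmf (truncated \<pi> N) (x - d) / pmf (truncated \<pi> N) y) ^ d
          \<le> 4 powr (\<alpha> * real d) * real x powr (-\<alpha>)" .
      have "real y * (pmf (truncated \<pi> N) (x - d) / pmf (truncated \<pi> N) y) ^ d
          * measure_pmf.prob (truncated \<pi> N) {x - d<..}
          \<le> real x * (4 powr (\<alpha> * real d) * real x powr (-\<alpha>)) * 1"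
        using ratio yx by (intro mult_mono) auto
      also have "\<dots> = 4 powr (\<alpha> * real d) * real x powr (1 - \<alpha>)"
        using elim(3) by (simp add: powr_diff powr_minus field_simps)
      also have "\<dots> \<le> 4 powr (\<alpha> * real d) * ?b"
      proof (intro mult_left_mono powr_mono)
        have "\<epsilon> * (1 - \<alpha>) \<le> 0" using assms exponent by (intro mult_nonneg_nonpos) auto
        then show "1 - \<alpha> \<le> (1 - \<epsilon>) * (1 - \<alpha>)" by (simp add: algebra_simps)
      qed (use elim(3) in auto)
      finally show "measure_pmf.prob (search_cost N (truncated \<pi> N)) {x<..} \<le> A * ?b"
        using search_cost_le[OF y1 yx] head xN unfolding A_def distrib_right by linarith
    qed
  qed
  moreover have "0 < A" using exponent by (simp add: A_def add_pos_pos)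
  ultimately show ?thesis by blast
qed

lemma log_tail_limit:
  assumes "\<gamma> < 1"
  shows "(log_tail_ratio \<pi> \<longlongrightarrow> 1) (joint_at_top (\<lambda>x N. real x / real N < \<gamma>))"
proof (rule log_tail_ratio_tendsto_1)
  show less: "x < N" if "real x / real N < \<gamma>" "1 \<le> x" "1 \<le> N" for x N :: nat
  proof -
    have "real x / real N < 1" using that(1) assms by simp
    then show ?thesis using that(3) by simp
  qed
  fix \<epsilon> :: real assume eps: "0 < \<epsilon>" "\<epsilon> < 1"
  show "\<forall>\<^sub>F x in sequentially. \<forall>N. 1 \<le> N \<longrightarrow> real x / real N < \<gamma> \<longrightarrow>
      measure_pmf.prob (search_cost N (truncated \<pi> N)) {x<..}
        \<le> measure_pmf.prob (truncated \<pi> N) {x<..} powr (1 - \<epsilon>)"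
  proof (cases "0 < \<gamma>")
    case False
    have "\<not> real x / real N < \<gamma>" for x N :: nat
      using False by (smt (verit) divide_nonneg_nonneg of_nat_0_le_iff)
    then show ?thesis by simp
  next
    case True
    define k where "k = pmf \<pi> 1 * min 1 (1 / \<gamma> - 1) * 2 powr (-\<alpha>)"
    have k: "0 < k" using True assms positive[of 1] by (simp add: k_def)
    obtain A where A: "0 < A" "\<forall>\<^sub>F x in sequentially. \<forall>N. x < N \<longrightarrow>
        measure_pmf.prob (search_cost N (truncated \<pi> N)) {x<..}
          \<le> A * real x powr ((1 - \<epsilon> / 2) * (1 - \<alpha>))"
      using search_cost_upper[of "\<epsilon> / 2"] eps by auto
    \<comment> \<open>half of \<open>\<epsilon>\<close> goes into the tail bound; the power \<open>x powr (- b)\<close> left over from the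
      other half absorbs the constants\<close>
    define b where "b = \<epsilon> / 2 * (\<alpha> - 1)"
    have b: "0 < b" using eps exponent by (simp add: b_def)
    have "(\<lambda>x. A * real x powr (-b)) \<longlonglongrightarrow> 0" using b by real_asymp
    then have "\<forall>\<^sub>F x in sequentially. A * real x powr (-b) < k powr (1 - \<epsilon>)"
      using k by (intro order_tendstoD) auto
    moreover have "\<forall>\<^sub>F x in sequentially. 1 \<le> x" by (rule eventually_ge_at_top)
    ultimately show ?thesis using A(2)
    proof eventually_elim
      case (elim x)
      show ?case
      proof (intro allI impI)
        fix N :: nat assume N: "1 \<le> N" "real x / real N < \<gamma>"
        have "measure_pmf.prob (search_cost N (truncated \<pi> N)) {x<..}
            \<le> A * real x powr ((1 - \<epsilon> / 2) * (1 - \<alpha>))"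
          using elim less N by blast
        also have "\<dots> = (A * real x powr (-b)) * real x powr ((1 - \<alpha>) * (1 - \<epsilon>))"
          by (simp add: b_def powr_add[symmetric] algebra_simps add_divide_distrib diff_divide_distrib)
        also have "\<dots> \<le> k powr (1 - \<epsilon>) * real x powr ((1 - \<alpha>) * (1 - \<epsilon>))"
          using elim(1) by (intro mult_right_mono) auto
        also have "\<dots> = (k * real x powr (1 - \<alpha>)) powr (1 - \<epsilon>)"
          using k by (simp add: powr_mult powr_powr)
        also have "\<dots> \<le> measure_pmf.prob (truncated \<pi> N) {x<..} powr (1 - \<epsilon>)"
          using prob_truncated_gt_lower[OF elim(2) N assms] k eps
          by (intro powr_mono2) (auto simp: k_def)
        finally show "measure_pmf.prob (search_cost N (truncated \<pi> N)) {x<..}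
            \<le> measure_pmf.prob (truncated \<pi> N) {x<..} powr (1 - \<epsilon>)" .
      qed
    qed
  qed
qed

end

lemma power_law_limit:
  assumes nonincr: "nonincreasing_distribution \<pi>" and power: "power_law \<alpha> \<pi>" and "\<gamma> < 1"
  shows "(log_tail_ratio \<pi> \<longlongrightarrow> 1) (joint_at_top (\<lambda>x N. real x / real N < \<gamma>))"
proof -
  have form: "pmf \<pi> i = pmf \<pi> 1 * real i powr (-\<alpha>)" if "1 \<le> i" for i
    using power that unfolding power_law_def by simp
  have pos: "0 < pmf \<pi> i" if "1 \<le> i" for i
    using nonincreasing_distribution_positive[OF nonincr] that by (subst form) auto
  interpret power_law_distribution \<pi> \<alpha>
  proof unfold_locales
    show "1 < \<alpha>" using power by (simp add: power_law_def)
  qed (fact nonincr pos form)+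
  show ?thesis by (rule log_tail_limit) fact
qed

section \<open>The logarithmic tail asymptotics\<close>

theorem theorem2:
  fixes \<pi> :: "nat pmf"
  assumes "nonincreasing_distribution \<pi>"
  shows "(\<forall>\<alpha> \<gamma>. power_law \<alpha> \<pi> \<longrightarrow> \<gamma> < 1 \<longrightarrow>
            (log_tail_ratio \<pi> \<longlongrightarrow> 1) (joint_at_top (\<lambda>x N. real x / real N < \<gamma>))) \<and>
         (\<forall>\<nu>. asymptotically_geometric \<nu> \<pi> \<longrightarrow>
            (log_tail_ratio \<pi> \<longlongrightarrow> 1) (joint_at_top (\<lambda>x N. x < N)))"
  using power_law_limit[OF assms] asymptotically_geometric_limit[OF assms] by blast

end
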